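(* Let $M\ge 1$ and let $(u_{h,1}^{n},u_{h,2}^{n})_{0\le n\le M+1}$, with $u_{h,i}^n\in V_i^h$, together with the tensors $\mathbb G_i^{\mathbb H,n}\in L_i^H$, be a solution of the GA-VMS scheme described in the context (for $n=1,\dots,M$, with given starting values $u_{h,i}^0,u_{h,i}^1\in V_i^h$). Then the following global energy conservation law holds: $$ \begin{aligned} &\|u_{h,1}^{M+1}\|_{\Omega_1}^2+\|u_{h,2}^{M+1}\|_{\Omega_2}^2+\nu_T\Delta t\big(\|\nabla u_{h,1}^{M+1}\|_{\Omega_1}^2+\|\nabla u_{h,2}^{M+1}\|_{\Omega_2}^2\big)\\ &+\sum_{n=1}^M\big(\|u_{h,1}^{n+1}-u_{h,1}^n\|_{\Omega_1}^2+\|u_{h,2}^{n+1}-u_{h,2}^n\|_{\Omega_2}^2\big)\\ &+\Delta t\sum_{n=1}^M\Big(2\nu_1\|\nabla u_{h,1}^{n+1}\|_{\Omega_1}^2+\nu_T\|\nabla u_{h,1}^{n+1}-\mathbb G_1^{\mathbb H,n}\|_{\Omega_1}^2+\nu_T\|\nabla u_{h,1}^{n}-\mathbb G_1^{\mathbb H,n}\|_{\Omega_1}^2\Big)\\ &+\Delta t\sum_{n=1}^M\Big(2\nu_2\|\nabla u_{h,2}^{n+1}\|_{\Omega_2}^2+\nu_T\|\nabla u_{h,2}^{n+1}-\mathbb G_2^{\mathbb H,n}\|_{\Omega_2}^2+\nu_T\|\nabla u_{h,2}^{n}-\mathbb G_2^{\mathbb H,n}\|_{\Omega_2}^2\Big)\\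 &+\kappa\Delta t\int_I|[\mathbf u_h^M]|\big(|u_{h,1}^{M+1}|^2+|u_{h,2}^{M+1}|^2\big)ds\\ &+\kappa\Delta t\sum_{n=1}^M\int_I\Big||[\mathbf u_h^n]|^{1/2}u_{h,1}^{n+1}-|[\mathbf u_h^{n-1}]|^{1/2}u_{h,2}^{n}\Big|^2ds\\ &+\kappa\Delta t\sum_{n=1}^M\int_I\Big||[\mathbf u_h^n]|^{1/2}u_{h,2}^{n+1}-|[\mathbf u_h^{n-1}]|^{1/2}u_{h,1}^{n}\Big|^2ds\\ =\;&\|u_{h,1}^{1}\|_{\Omega_1}^2+\|u_{h,2}^{1}\|_{\Omega_2}^2+\nu_T\Delta t\big(\|\nabla u_{h,1}^{1}\|_{\Omega_1}^2+\|\nabla u_{h,2}^{1}\|_{\Omega_2}^2\big)+\kappa\Delta t\int_I|[\mathbf u_h^0]|\big(|u_{h,1}^{1}|^2+|u_{h,2}^{1}|^2\big)ds\\ &+2\Delta t\sum_{n=1}^M(f_1^{n+1},u_{h,1}^{n+1})_{\Omega_1}+2\Delta t\sum_{n=1}^M(f_2^{n+1},u_{h,2}^{n+1})_{\Omega_2}. \end{aligned} $$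
   Context: Setting. $d\in\{2,3\}$; $\Omega\subset\mathbb R^d$ is a polygonal/polyhedral domain consisting of two subdomains $\Omega_1,\Omega_2$ coupled across an interface $I$; $\hat n_i$ is the unit normal on $\partial\Omega_i$. Constants: viscosities $\nu_1,\nu_2>0$, friction parameter $\kappa\in\mathbb R$, eddy viscosity $\nu_T\ge 0$ (a constant depending on the mesh size $h$), time step $\Delta t>0$, $t^n=n\Delta t$. Body forces $f_i$ are functions of time with values in functions on $\Omega_i$, and $f_i^{n}=f_i(t^n)$ (assumed defined at all time levels used). Spaces. $X_i=\{v\in L^2(\Omega_i)^d:\nabla v\in L^2(\Omega_i)^{d\times d},\ v=0\text{ on }\partial\Omega_i\setminus I,\ v\cdot\hat n_i=0\text{ on }I\}$, $Q_i=L^2_0(\Omega_i)$ (mean-zero functions). $X_i^h\subset X_i$, $Q_i^h\subset Q_i$ are conforming finite element spaces satisfying the discrete inf-sup condition. $V_i^h=\{v\in X_i^h:(q,\nabla\cdot v)_{\Omega_i}=0\ \forall q\in Q_i^h\}$. $L_i^H\subset L^2(\Omega_i)^{d\times d}$ is a finite dimensional (large scale) space. Notation. $(\cdot,\cdot)_{\Omega_i}$ and $\|\cdot\|_{\Omega_i}$ are the $L^2(\Omega_i)$ inner product and norm. For $\mathbf u=(u_1,u_2)$, $[\mathbf u]=u_1-u_2$ is the jump across $I$; $|\cdot|$ is the Euclidean norm; products of vectors in integrals over $I$ are Euclidean dot products. $\mathbf u_h^n=(u_{h,1}^n,u_{h,2}^n)$. The skew-symmetrized trilinear form is $c_i(u;v,w)=\frac12(u\cdot\nabla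 v,w)_{\Omega_i}-\frac12(u\cdot\nabla w,v)_{\Omega_i}$. GA-VMS scheme. Given $u_{h,i}^0,u_{h,i}^1\in V_i^h$, for $n\ge1$ and $i,j\in\{1,2\}$, $i\ne j$, $u_{h,i}^{n+1}\in V_i^h$ and $\mathbb G_i^{\mathbb H,n}\in L_i^H$ satisfy, for all $v\in V_i^h$ and all $\mathbb L\in L_i^H$, $$\Big(\tfrac{u_{h,i}^{n+1}-u_{h,i}^n}{\Delta t},v\Big)_{\Omega_i}+(\nu_i+\nu_T)(\nabla u_{h,i}^{n+1},\nabla v)_{\Omega_i}+c_i(u_{h,i}^{n+1};u_{h,i}^{n+1},v)+\kappa\int_I|[\mathbf u_h^n]|\,u_{h,i}^{n+1}\cdot v\,ds-\kappa\int_I|[\mathbf u_h^n]|^{1/2}|[\mathbf u_h^{n-1}]|^{1/2}\,u_{h,j}^n\cdot v\,ds=(f_i^{n+1},v)_{\Omega_i}+\nu_T(\mathbb G_i^{\mathbb H,n},\nabla v)_{\Omega_i},$$ $$(\mathbb G_i^{\mathbb H,n}-\nabla u_{h,i}^n,\mathbb L)_{\Omega_i}=0 .$$ *)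

theory Defs
  imports "HOL-Analysis.Analysis"
begin

section \<open>Square integrable functions\<close>

definition L2 :: "'a measure \<Rightarrow> ('a \<Rightarrow> 'b::euclidean_space) set" where
  "L2 M = {f. f \<in> borel_measurable M \<and> integrable M (\<lambda>x. (norm (f x))\<^sup>2)}"

text \<open>On matrix-valued functions the inner product below is the Frobenius one, since \<open>\<bullet>\<close> on
  \<^typ>\<open>real^'d^'d\<close> is the sum of the products of all entries.\<close>

definition l2_inner :: "'a measure \<Rightarrow> ('a \<Rightarrow> 'b::euclidean_space) \<Rightarrow> ('a \<Rightarrow> 'b) \<Rightarrow> real" where
  "l2_inner M f g = (LINT x|M. f x \<bullet> g x)"

definition l2_norm :: "'a measure \<Rightarrow> ('a \<Rightarrow> 'b::euclidean_space) \<Rightarrow> real" where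
  "l2_norm M f = sqrt (LINT x|M. (norm (f x))\<^sup>2)"

abbreviation inner_dom ::
  "(real^'d) set \<Rightarrow> (real^'d \<Rightarrow> 'b::euclidean_space) \<Rightarrow> (real^'d \<Rightarrow> 'b) \<Rightarrow> real" where
  "inner_dom \<Omega> \<equiv> l2_inner (lebesgue_on \<Omega>)"

abbreviation norm_dom :: "(real^'d) set \<Rightarrow> (real^'d \<Rightarrow> 'b::euclidean_space) \<Rightarrow> real" where
  "norm_dom \<Omega> \<equiv> l2_norm (lebesgue_on \<Omega>)"

section \<open>Surface measure\<close>

text \<open>The \<open>s\<close>-dimensional Hausdorff outer measure, with the normalization for which it agrees with
  Lebesgue measure on flat \<open>s\<close>-dimensional pieces.  Covering sets are required to be bounded because
  \<^const>\<open>diameter\<close> is only meaningful for bounded sets.\<close>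

definition hausdorff_outer :: "nat \<Rightarrow> 'a::metric_space set \<Rightarrow> ennreal" where
  "hausdorff_outer s A =
    (SUP \<delta>\<in>{0<..}. INF C\<in>{C :: nat \<Rightarrow> 'a set.
        A \<subseteq> (\<Union>j. C j) \<and> (\<forall>j. bounded (C j) \<and> diameter (C j) \<le> \<delta>)}.
      (\<Sum>j. ennreal (unit_ball_vol (real s) * (diameter (C j) / 2) ^ s)))"

text \<open>The element \<open>ds\<close> is \<open>(d - 1)\<close>-dimensional Hausdorff measure on the Borel sets; by
  Caratheodory's criterion the outer measure is countably additive there.\<close>

definition surface_measure :: "(real^'d) measure" where
  "surface_measure = measure_of UNIV (sets borel) (hausdorff_outer (CARD('d) - 1))"

section \<open>Polygonal and polyhedral domains\<close>

text \<open>The last condition excludes slits, along which the boundary would be two-sided.\<close>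

definition polytopal_domain :: "(real^'d) set \<Rightarrow> bool" where
  "polytopal_domain \<Omega> \<longleftrightarrow> open \<Omega> \<and> connected \<Omega> \<and> \<Omega> \<noteq> {} \<and>
    (\<exists>F. finite F \<and> (\<forall>P\<in>F. polytope P) \<and> closure \<Omega> = \<Union>F) \<and>
    \<Omega> = interior (closure \<Omega>)"

definition coupled_domain ::
  "(real^'d) set \<Rightarrow> (real^'d) set \<Rightarrow> (real^'d) set \<Rightarrow> (real^'d) set \<Rightarrow> bool" where
  "coupled_domain D \<Omega>1 \<Omega>2 \<Gamma> \<longleftrightarrow>
    polytopal_domain D \<and> polytopal_domain \<Omega>1 \<and> polytopal_domain \<Omega>2 \<and>
    \<Omega>1 \<inter> \<Omega>2 = {} \<and> closure D = closure \<Omega>1 \<union> closure \<Omega>2 \<and>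
    \<Gamma> = frontier \<Omega>1 \<inter> frontier \<Omega>2"

text \<open>Outer unit normal at a flat boundary point; on the boundary of a polytopal domain it exists
  (and is then unique) at almost every point, the exceptions lying on edges and vertices.\<close>

definition outer_unit_normal :: "(real^'d) set \<Rightarrow> real^'d \<Rightarrow> real^'d \<Rightarrow> bool" where
  "outer_unit_normal \<Omega> x n \<longleftrightarrow> norm n = 1 \<and>
    (\<exists>r>0. \<Omega> \<inter> ball x r = {y \<in> ball x r. (y - x) \<bullet> n < 0})"

section \<open>Sobolev spaces\<close>

definition C1 :: "('a::real_normed_vector \<Rightarrow> 'b::real_normed_vector) \<Rightarrow> bool" where
  "C1 f \<longleftrightarrow> (\<exists>f' :: 'a \<Rightarrow> 'a \<Rightarrow>\<^sub>L 'b.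
    (\<forall>x. (f has_derivative blinfun_apply (f' x)) (at x)) \<and> continuous_on UNIV f')"

definition test_function :: "(real^'d) set \<Rightarrow> (real^'d \<Rightarrow> real) \<Rightarrow> bool" where
  "test_function \<Omega> \<phi> \<longleftrightarrow> C1 \<phi> \<and> compact (closure {x. \<phi> x \<noteq> 0}) \<and> closure {x. \<phi> x \<noteq> 0} \<subseteq> \<Omega>"

text \<open>Convention: the entry \<open>G x $ i $ j\<close> is the partial derivative of the component \<open>v $ i\<close> in the
  direction \<open>j\<close>.\<close>

definition is_weak_grad ::
  "(real^'d) set \<Rightarrow> (real^'d \<Rightarrow> real^'d) \<Rightarrow> (real^'d \<Rightarrow> real^'d^'d) \<Rightarrow> bool" where
  "is_weak_grad \<Omega> v G \<longleftrightarrow> (\<forall>\<phi>. test_function \<Omega> \<phi> \<longrightarrow> (\<forall>i j.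
    (LINT x|lebesgue_on \<Omega>. v x $ i * frechet_derivative \<phi> (at x) (axis j 1)) =
    - (LINT x|lebesgue_on \<Omega>. G x $ i $ j * \<phi> x)))"

definition H1 :: "(real^'d) set \<Rightarrow> (real^'d \<Rightarrow> real^'d) set" where
  "H1 \<Omega> = {v \<in> L2 (lebesgue_on \<Omega>). \<exists>G \<in> L2 (lebesgue_on \<Omega>). is_weak_grad \<Omega> v G}"

definition wgrad :: "(real^'d) set \<Rightarrow> (real^'d \<Rightarrow> real^'d) \<Rightarrow> real^'d \<Rightarrow> real^'d^'d" where
  "wgrad \<Omega> v = (SOME G. G \<in> L2 (lebesgue_on \<Omega>) \<and> is_weak_grad \<Omega> v G)"

text \<open>Here \<^const>\<open>trace\<close> is the matrix trace.\<close>

definition wdiv :: "(real^'d) set \<Rightarrow> (real^'d \<Rightarrow> real^'d) \<Rightarrow> real^'d \<Rightarrow> real" where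
  "wdiv \<Omega> v x = trace (wgrad \<Omega> v x)"

text \<open>The function \<open>g\<close> is the boundary trace of \<open>v \<in> H1 \<Omega>\<close>: the trace operator is the continuous
  extension of the restriction of smooth functions to the boundary.\<close>

definition boundary_trace ::
  "(real^'d) set \<Rightarrow> (real^'d \<Rightarrow> real^'d) \<Rightarrow> (real^'d \<Rightarrow> real^'d) \<Rightarrow> bool" where
  "boundary_trace \<Omega> v g \<longleftrightarrow>
    g \<in> L2 (restrict_space surface_measure (frontier \<Omega>)) \<and>
    (\<exists>w :: nat \<Rightarrow> real^'d \<Rightarrow> real^'d. (\<forall>k. C1 (w k)) \<and>
      (\<lambda>k. norm_dom \<Omega> (\<lambda>x. w k x - v x)) \<longlonglongrightarrow> 0 \<and>
      (\<lambda>k. norm_dom \<Omega> (\<lambda>x. jacobian (w k) (at x) - wgrad \<Omega> v x)) \<longlonglongrightarrow> 0 \<and>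
      (\<lambda>k. l2_norm (restrict_space surface_measure (frontier \<Omega>)) (\<lambda>x. w k x - g x)) \<longlonglongrightarrow> 0)"

text \<open>Elements of the velocity space are represented by functions on the closed domain whose values
  on the boundary are their own trace, so boundary conditions and integrals over the interface can
  be written with pointwise values.  Values outside the closure of the domain are irrelevant.\<close>

definition velocity_space ::
  "(real^'d) set \<Rightarrow> (real^'d) set \<Rightarrow> (real^'d \<Rightarrow> real^'d) set" where
  "velocity_space \<Omega> \<Gamma> = {v \<in> H1 \<Omega>. boundary_trace \<Omega> v v \<and>
    (AE x in surface_measure. x \<in> frontier \<Omega> - \<Gamma> \<longrightarrow> v x = 0) \<and>
    (AE x in surface_measure. x \<in> \<Gamma> \<longrightarrow> (\<forall>n. outer_unit_normal \<Omega> x n \<longrightarrow> v x \<bullet> n = 0))}"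

definition pressure_space :: "(real^'d) set \<Rightarrow> (real^'d \<Rightarrow> real) set" where
  "pressure_space \<Omega> = {q \<in> L2 (lebesgue_on \<Omega>). (LINT x|lebesgue_on \<Omega>. q x) = 0}"

section \<open>Discrete spaces\<close>

text \<open>A finite dimensional linear space of functions on \<open>\<Omega>\<close>, functions being identified when they
  agree almost everywhere on \<open>\<Omega>\<close>.\<close>

definition fin_dim_space :: "(real^'d) set \<Rightarrow> (real^'d \<Rightarrow> 'b::euclidean_space) set \<Rightarrow> bool" where
  "fin_dim_space \<Omega> Y \<longleftrightarrow> Y \<noteq> {} \<and>
    (\<forall>v\<in>Y. \<forall>w\<in>Y. \<forall>a b. (\<lambda>x. a *\<^sub>R v x + b *\<^sub>R w x) \<in> Y) \<and>
    (\<exists>B. finite B \<and> B \<subseteq> Y \<and>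
      (\<forall>v\<in>Y. \<exists>c. AE x in lebesgue_on \<Omega>. v x = (\<Sum>b\<in>B. c b *\<^sub>R b x)))"

definition polytopal_mesh :: "(real^'d) set \<Rightarrow> (real^'d) set set \<Rightarrow> bool" where
  "polytopal_mesh \<Omega> T \<longleftrightarrow> finite T \<and> (\<forall>K\<in>T. polytope K \<and> interior K \<noteq> {}) \<and>
    \<Union>T = closure \<Omega> \<and> (\<forall>K\<in>T. \<forall>K'\<in>T. K \<noteq> K' \<longrightarrow> interior K \<inter> interior K' = {})"

text \<open>Finite element spaces: on each mesh cell the functions are continuously differentiable up to
  the boundary of the cell, which covers polynomial as well as mapped shape functions.  Elements of
  the conforming velocity space are single-valued on closed cells and hence continuous on the closed
  domain, whereas pressures may jump between cells.\<close>

definition fe_velocity_space ::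
  "(real^'d) set \<Rightarrow> (real^'d) set \<Rightarrow> (real^'d \<Rightarrow> real^'d) set \<Rightarrow> bool" where
  "fe_velocity_space \<Omega> \<Gamma> X \<longleftrightarrow> fin_dim_space \<Omega> X \<and> X \<subseteq> velocity_space \<Omega> \<Gamma> \<and>
    (\<exists>T. polytopal_mesh \<Omega> T \<and> (\<forall>v\<in>X. \<forall>K\<in>T. \<exists>g. C1 g \<and> (\<forall>x\<in>K. v x = g x)))"

definition fe_pressure_space :: "(real^'d) set \<Rightarrow> (real^'d \<Rightarrow> real) set \<Rightarrow> bool" where
  "fe_pressure_space \<Omega> Q \<longleftrightarrow> fin_dim_space \<Omega> Q \<and> Q \<subseteq> pressure_space \<Omega> \<and>
    (\<exists>T. polytopal_mesh \<Omega> T \<and> (\<forall>q\<in>Q. \<forall>K\<in>T. \<exists>g. C1 g \<and> (\<forall>x\<in>interior K. q x = g x)))"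

definition discrete_inf_sup ::
  "(real^'d) set \<Rightarrow> (real^'d \<Rightarrow> real^'d) set \<Rightarrow> (real^'d \<Rightarrow> real) set \<Rightarrow> bool" where
  "discrete_inf_sup \<Omega> X Q \<longleftrightarrow> (\<exists>\<beta>>0. ereal \<beta> \<le>
    (INF q\<in>{q \<in> Q. norm_dom \<Omega> q \<noteq> 0}. SUP v\<in>{v \<in> X. norm_dom \<Omega> (wgrad \<Omega> v) \<noteq> 0}.
      ereal (inner_dom \<Omega> q (wdiv \<Omega> v) / (norm_dom \<Omega> q * norm_dom \<Omega> (wgrad \<Omega> v)))))"

definition discretely_div_free ::
  "(real^'d) set \<Rightarrow> (real^'d \<Rightarrow> real^'d) set \<Rightarrow> (real^'d \<Rightarrow> real) set \<Rightarrow> (real^'d \<Rightarrow> real^'d) set" where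
  "discretely_div_free \<Omega> X Q = {v \<in> X. \<forall>q\<in>Q. inner_dom \<Omega> q (wdiv \<Omega> v) = 0}"

definition large_scale_space :: "(real^'d) set \<Rightarrow> (real^'d \<Rightarrow> real^'d^'d) set \<Rightarrow> bool" where
  "large_scale_space \<Omega> L \<longleftrightarrow> fin_dim_space \<Omega> L \<and> L \<subseteq> L2 (lebesgue_on \<Omega>)"

section \<open>The scheme\<close>

text \<open>With the convention for \<^const>\<open>wgrad\<close> above, \<open>wgrad \<Omega> v x *v u x\<close> is \<open>(u \<cdot> \<nabla>) v\<close> at \<open>x\<close>.\<close>

definition trilinear :: "(real^'d) set \<Rightarrow> (real^'d \<Rightarrow> real^'d) \<Rightarrow> (real^'d \<Rightarrow> real^'d)
    \<Rightarrow> (real^'d \<Rightarrow> real^'d) \<Rightarrow> real" where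
  "trilinear \<Omega> u v w =
    1/2 * inner_dom \<Omega> (\<lambda>x. wgrad \<Omega> v x *v u x) w - 1/2 * inner_dom \<Omega> (\<lambda>x. wgrad \<Omega> w x *v u x) v"

text \<open>In what follows \<open>u i n\<close> is the velocity on subdomain \<open>i \<in> {1, 2}\<close> at time level \<open>n\<close>.\<close>

definition jump :: "(nat \<Rightarrow> nat \<Rightarrow> real^'d \<Rightarrow> real^'d) \<Rightarrow> nat \<Rightarrow> real^'d \<Rightarrow> real^'d" where
  "jump u n x = u 1 n x - u 2 n x"

definition ga_vms_solution ::
  "(nat \<Rightarrow> (real^'d) set) \<Rightarrow> (real^'d) set \<Rightarrow> (nat \<Rightarrow> real) \<Rightarrow> real \<Rightarrow> real \<Rightarrow> real
    \<Rightarrow> (nat \<Rightarrow> real \<Rightarrow> real^'d \<Rightarrow> real^'d)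
    \<Rightarrow> (nat \<Rightarrow> (real^'d \<Rightarrow> real^'d) set) \<Rightarrow> (nat \<Rightarrow> (real^'d \<Rightarrow> real^'d^'d) set)
    \<Rightarrow> nat \<Rightarrow> (nat \<Rightarrow> nat \<Rightarrow> real^'d \<Rightarrow> real^'d) \<Rightarrow> (nat \<Rightarrow> nat \<Rightarrow> real^'d \<Rightarrow> real^'d^'d) \<Rightarrow> bool" where
  "ga_vms_solution \<Omega> \<Gamma> \<nu> \<nu>T \<kappa> \<Delta>t f V L M u G \<longleftrightarrow>
    (\<forall>i\<in>{1,2}. \<forall>n\<le>M+1. u i n \<in> V i) \<and>
    (\<forall>i\<in>{1,2}. \<forall>n\<in>{1..M}. G i n \<in> L i) \<and>
    (\<forall>i\<in>{1,2}. \<forall>j\<in>{1,2}. i \<noteq> j \<longrightarrow> (\<forall>n\<in>{1..M}.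
      (\<forall>v\<in>V i.
        inner_dom (\<Omega> i) (\<lambda>x. (1/\<Delta>t) *\<^sub>R (u i (n+1) x - u i n x)) v
        + (\<nu> i + \<nu>T) * inner_dom (\<Omega> i) (wgrad (\<Omega> i) (u i (n+1))) (wgrad (\<Omega> i) v)
        + trilinear (\<Omega> i) (u i (n+1)) (u i (n+1)) v
        + \<kappa> * (LINT x:\<Gamma>|surface_measure. norm (jump u n x) * (u i (n+1) x \<bullet> v x))
        - \<kappa> * (LINT x:\<Gamma>|surface_measure.
            sqrt (norm (jump u n x)) * sqrt (norm (jump u (n-1) x)) * (u j n x \<bullet> v x))
        = inner_dom (\<Omega> i) (f i (real (n+1) * \<Delta>t)) v
          + \<nu>T * inner_dom (\<Omega> i) (G i n) (wgrad (\<Omega> i) v)) \<and>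
      (\<forall>\<Lambda>\<in>L i. inner_dom (\<Omega> i) (\<lambda>x. G i n x - wgrad (\<Omega> i) (u i n) x) \<Lambda> = 0)))"

end

(* Energy estimate: test with the new velocity, which kills the skew-symmetric convection term, and
   test the projection equation with G itself, which gives (G, grad u) = |G|^2 for the old velocity u.
   All remaining terms are then of the form 2 |a|^2 - 2 (b, a) = |a|^2 - |b|^2 + |a - b|^2.  On the
   interface this is applied to a = |[u^n]|^(1/2) u_i^(n+1) and b = |[u^(n-1)]|^(1/2) u_j^n; these are
   square integrable because finite element functions are bounded.  The index exchange i, j in b makes
   the interface energies telescope only after summation over both subdomains. *)

theory Submission
  imports Defs
begin

section \<open>Square integrable functions and their inner product\<close>

lemma L2_measurable: "f \<in> L2 M \<Longrightarrow> f \<in> borel_measurable M"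
  by (simp add: L2_def)

text \<open>The product is dominated by |f|^2 + |g|^2, by Cauchy-Schwarz and 2ab \<le> a^2 + b^2.
  This supplies the integrability on which every splitting of an integral below depends.\<close>

lemma L2_integrable_inner:
  assumes f: "f \<in> L2 M" and g: "g \<in> L2 M"
  shows "integrable M (\<lambda>x. f x \<bullet> g x)"
proof (rule Bochner_Integration.integrable_bound)
  show "integrable M (\<lambda>x. (norm (f x))\<^sup>2 + (norm (g x))\<^sup>2)"
    using f g by (simp add: L2_def)
  show "(\<lambda>x. f x \<bullet> g x) \<in> borel_measurable M"
    using f g by (intro borel_measurable_inner L2_measurable)
  have "\<bar>f x \<bullet> g x\<bar> \<le> (norm (f x))\<^sup>2 + (norm (g x))\<^sup>2" for x
  proof -
    have "\<bar>f x \<bullet> g x\<bar> \<le> norm (f x) * norm (g x)"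
      by (rule Cauchy_Schwarz_ineq2)
    also have "\<dots> \<le> 2 * norm (f x) * norm (g x)"
      by simp
    also have "\<dots> \<le> (norm (f x))\<^sup>2 + (norm (g x))\<^sup>2"
      by (rule sum_squares_bound)
    finally show ?thesis .
  qed
  then show "AE x in M. norm (f x \<bullet> g x) \<le> norm ((norm (f x))\<^sup>2 + (norm (g x))\<^sup>2)"
    by simp
qed

lemma l2_norm_power2: "(l2_norm M f)\<^sup>2 = l2_inner M f f"
  by (simp add: l2_norm_def l2_inner_def power2_norm_eq_inner)

lemma l2_inner_commute: "l2_inner M f g = l2_inner M g f"
  by (simp add: l2_inner_def inner_commute)

lemma l2_inner_scaleR_left: "l2_inner M (\<lambda>x. c *\<^sub>R f x) g = c * l2_inner M f g"
  by (simp add: l2_inner_def)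

lemma l2_inner_diff_left:
  "f \<in> L2 M \<Longrightarrow> g \<in> L2 M \<Longrightarrow> h \<in> L2 M \<Longrightarrow>
    l2_inner M (\<lambda>x. f x - g x) h = l2_inner M f h - l2_inner M g h"
  by (simp add: l2_inner_def inner_diff_left L2_integrable_inner)

text \<open>Read as 2 (f, f) - 2 (g, f) = |f|^2 - |g|^2 + |f - g|^2, this turns each tested term
  into a difference of energies plus a dissipation.\<close>

lemma l2_norm_diff_power2:
  assumes "f \<in> L2 M" and "g \<in> L2 M"
  shows "(l2_norm M (\<lambda>x. f x - g x))\<^sup>2 = l2_inner M f f - 2 * l2_inner M g f + l2_inner M g g"
  unfolding l2_norm_power2 using assms
  by (simp add: l2_inner_def inner_diff_left inner_diff_right L2_integrable_inner inner_commute)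

text \<open>Traces are given on a whole boundary, while the interface is only a part of it.
  Restricting twice is restricting once to the smaller set, and multiplying by a measurable
  indicator preserves integrability.\<close>

lemma L2_restrict_subset:
  assumes f: "f \<in> L2 (restrict_space M A)"
    and "A \<in> sets M" and "B \<in> sets M" and "B \<subseteq> A"
  shows "f \<in> L2 (restrict_space M B)"
proof -
  have restr: "restrict_space (restrict_space M A) B = restrict_space M B"
    using assms(2-4) by (simp add: restrict_restrict_space Int_absorb1)
  have "B \<in> sets (restrict_space M A)"
    using assms(2-4) by (auto simp: sets_restrict_space)
  then show ?thesis
    using f by (auto simp: L2_def integrable_restrict_space[of B "restrict_space M A"]
        measurable_restrict_space1 sets.Int_space_eq2
        integrable_mult_indicator[where 'b=real, simplified]
        simp flip: restr)
qed

text \<open>The squared norm is dominated by C^2 |f|^2. The factor \<open>c\<close> will be the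
  interface weight |[u]|^(1/2).\<close>

lemma L2_scaleR_bounded:
  assumes f: "f \<in> L2 M" and c: "c \<in> borel_measurable M"
    and C: "\<And>x. x \<in> space M \<Longrightarrow> \<bar>c x\<bar> \<le> C"
  shows "(\<lambda>x. c x *\<^sub>R f x) \<in> L2 M"
proof -
  have "integrable M (\<lambda>x. (norm (c x *\<^sub>R f x))\<^sup>2)"
  proof (rule Bochner_Integration.integrable_bound)
    show "integrable M (\<lambda>x. C\<^sup>2 * (norm (f x))\<^sup>2)"
      using f by (simp add: L2_def)
    show "(\<lambda>x. (norm (c x *\<^sub>R f x))\<^sup>2) \<in> borel_measurable M"
      using L2_measurable[OF f] c by simp
    have "(c x)\<^sup>2 \<le> C\<^sup>2" if "x \<in> space M" for x
      using power_mono[OF C[OF that], of 2] by simp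
    then show "AE x in M. norm ((norm (c x *\<^sub>R f x))\<^sup>2) \<le> norm (C\<^sup>2 * (norm (f x))\<^sup>2)"
      by (intro AE_I2) (simp add: power_mult_distrib mult_right_mono)
  qed
  then show ?thesis
    using L2_measurable[OF f] c by (simp add: L2_def)
qed

text \<open>\<open>measure_of\<close> takes its measurable sets from the generating family alone,
  and the Borel sets already form a sigma-algebra.\<close>

lemma sets_surface_measure: "sets surface_measure = sets borel"
  by (simp add: surface_measure_def sets.sigma_sets_eq[of borel, simplified])

lemma wgrad_L2:
  assumes "v \<in> H1 \<Omega>"
  shows "wgrad \<Omega> v \<in> L2 (lebesgue_on \<Omega>)"
proof -
  have "\<exists>G. G \<in> L2 (lebesgue_on \<Omega>) \<and> is_weak_grad \<Omega> v G"
    using assms by (auto simp: H1_def)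
  from someI_ex[OF this] show ?thesis
    unfolding wgrad_def by (rule conjunct1)
qed

text \<open>Skew symmetry: with equal last arguments both halves are the same number.\<close>

lemma trilinear_self: "trilinear \<Omega> u v v = 0"
  by (simp add: trilinear_def)

text \<open>On each closed cell the function equals a continuous one, so its image of the compact
  cell is bounded, and finitely many cells cover the closure. Closed cells matter: the bound has to
  hold at every point of the interface.\<close>

lemma fe_velocity_space_bounded_image:
  assumes "fe_velocity_space \<Omega> \<Gamma> X" and v: "v \<in> X"
  shows "bounded (v ` closure \<Omega>)"
proof -
  obtain T where T: "polytopal_mesh \<Omega> T"
    and C1: "\<forall>v\<in>X. \<forall>K\<in>T. \<exists>g. C1 g \<and> (\<forall>x\<in>K. v x = g x)"
    using assms(1) unfolding fe_velocity_space_def by (elim conjE exE)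
  have "bounded (v ` K)" if K: "K \<in> T" for K
  proof -
    obtain g where "C1 g" and g: "\<forall>x\<in>K. v x = g x"
      using bspec[OF bspec[OF C1 v] K] by (elim exE conjE)
    have "compact K"
      using T K by (simp add: polytopal_mesh_def polytope_imp_compact)
    moreover have "continuous_on K g"
      using \<open>C1 g\<close> has_derivative_continuous unfolding C1_def
      by (intro continuous_at_imp_continuous_on) blast
    ultimately have "bounded (g ` K)"
      by (simp add: compact_continuous_image compact_imp_bounded)
    moreover have "v ` K = g ` K"
      using g by simp
    ultimately show ?thesis by simp
  qed
  moreover have "finite T" and "v ` closure \<Omega> = (\<Union>K\<in>T. v ` K)"
    using T unfolding polytopal_mesh_def by (auto simp flip: image_Union)
  ultimately show ?thesis
    by (simp add: bounded_UN)
qed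

theorem lemma4p1:
  fixes D \<Gamma> :: "(real^'d) set"
    and \<Omega> :: "nat \<Rightarrow> (real^'d) set"
    and \<nu> :: "nat \<Rightarrow> real"
    and \<nu>T \<kappa> \<Delta>t :: real
    and f :: "nat \<Rightarrow> real \<Rightarrow> real^'d \<Rightarrow> real^'d"
    and X :: "nat \<Rightarrow> (real^'d \<Rightarrow> real^'d) set"
    and Q :: "nat \<Rightarrow> (real^'d \<Rightarrow> real) set"
    and V :: "nat \<Rightarrow> (real^'d \<Rightarrow> real^'d) set"
    and L :: "nat \<Rightarrow> (real^'d \<Rightarrow> real^'d^'d) set"
    and M :: nat
    and u :: "nat \<Rightarrow> nat \<Rightarrow> real^'d \<Rightarrow> real^'d"
    and G :: "nat \<Rightarrow> nat \<Rightarrow> real^'d \<Rightarrow> real^'d^'d"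
  assumes "CARD('d) \<in> {2, 3}"
    and "coupled_domain D (\<Omega> 1) (\<Omega> 2) \<Gamma>"
    and "\<nu> 1 > 0" and "\<nu> 2 > 0" and "\<nu>T \<ge> 0" and "\<Delta>t > 0"
    and "\<And>i. i \<in> {1, 2} \<Longrightarrow> fe_velocity_space (\<Omega> i) \<Gamma> (X i)"
    and "\<And>i. i \<in> {1, 2} \<Longrightarrow> fe_pressure_space (\<Omega> i) (Q i)"
    and "\<And>i. i \<in> {1, 2} \<Longrightarrow> discrete_inf_sup (\<Omega> i) (X i) (Q i)"
    and "\<And>i. i \<in> {1, 2} \<Longrightarrow> V i = discretely_div_free (\<Omega> i) (X i) (Q i)"
    and "\<And>i. i \<in> {1, 2} \<Longrightarrow> large_scale_space (\<Omega> i) (L i)"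
    and "M \<ge> 1"
    and "ga_vms_solution \<Omega> \<Gamma> \<nu> \<nu>T \<kappa> \<Delta>t f V L M u G"
  shows
    "(norm_dom (\<Omega> 1) (u 1 (M+1)))\<^sup>2 + (norm_dom (\<Omega> 2) (u 2 (M+1)))\<^sup>2
      + \<nu>T * \<Delta>t * ((norm_dom (\<Omega> 1) (wgrad (\<Omega> 1) (u 1 (M+1))))\<^sup>2
                  + (norm_dom (\<Omega> 2) (wgrad (\<Omega> 2) (u 2 (M+1))))\<^sup>2)
      + (\<Sum>n=1..M. (norm_dom (\<Omega> 1) (\<lambda>x. u 1 (n+1) x - u 1 n x))\<^sup>2
                 + (norm_dom (\<Omega> 2) (\<lambda>x. u 2 (n+1) x - u 2 n x))\<^sup>2)
      + \<Delta>t * (\<Sum>n=1..M.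
            2 * \<nu> 1 * (norm_dom (\<Omega> 1) (wgrad (\<Omega> 1) (u 1 (n+1))))\<^sup>2
            + \<nu>T * (norm_dom (\<Omega> 1) (\<lambda>x. wgrad (\<Omega> 1) (u 1 (n+1)) x - G 1 n x))\<^sup>2
            + \<nu>T * (norm_dom (\<Omega> 1) (\<lambda>x. wgrad (\<Omega> 1) (u 1 n) x - G 1 n x))\<^sup>2)
      + \<Delta>t * (\<Sum>n=1..M.
            2 * \<nu> 2 * (norm_dom (\<Omega> 2) (wgrad (\<Omega> 2) (u 2 (n+1))))\<^sup>2
            + \<nu>T * (norm_dom (\<Omega> 2) (\<lambda>x. wgrad (\<Omega> 2) (u 2 (n+1)) x - G 2 n x))\<^sup>2
            + \<nu>T * (norm_dom (\<Omega> 2) (\<lambda>x. wgrad (\<Omega> 2) (u 2 n) x - G 2 n x))\<^sup>2)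
      + \<kappa> * \<Delta>t * (LINT x:\<Gamma>|surface_measure.
            norm (jump u M x) * ((norm (u 1 (M+1) x))\<^sup>2 + (norm (u 2 (M+1) x))\<^sup>2))
      + \<kappa> * \<Delta>t * (\<Sum>n=1..M. LINT x:\<Gamma>|surface_measure.
            (norm (sqrt (norm (jump u n x)) *\<^sub>R u 1 (n+1) x
                   - sqrt (norm (jump u (n-1) x)) *\<^sub>R u 2 n x))\<^sup>2)
      + \<kappa> * \<Delta>t * (\<Sum>n=1..M. LINT x:\<Gamma>|surface_measure.
            (norm (sqrt (norm (jump u n x)) *\<^sub>R u 2 (n+1) x
                   - sqrt (norm (jump u (n-1) x)) *\<^sub>R u 1 n x))\<^sup>2)
     = (norm_dom (\<Omega> 1) (u 1 1))\<^sup>2 + (norm_dom (\<Omega> 2) (u 2 1))\<^sup>2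
      + \<nu>T * \<Delta>t * ((norm_dom (\<Omega> 1) (wgrad (\<Omega> 1) (u 1 1)))\<^sup>2
                  + (norm_dom (\<Omega> 2) (wgrad (\<Omega> 2) (u 2 1)))\<^sup>2)
      + \<kappa> * \<Delta>t * (LINT x:\<Gamma>|surface_measure.
            norm (jump u 0 x) * ((norm (u 1 1 x))\<^sup>2 + (norm (u 2 1 x))\<^sup>2))
      + 2 * \<Delta>t * (\<Sum>n=1..M. inner_dom (\<Omega> 1) (f 1 (real (n+1) * \<Delta>t)) (u 1 (n+1)))
      + 2 * \<Delta>t * (\<Sum>n=1..M. inner_dom (\<Omega> 2) (f 2 (real (n+1) * \<Delta>t)) (u 2 (n+1)))"
proof -
  note fe = assms(7) and Vdef = assms(10) and large = assms(11) and sol = assms(13)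
  have \<Gamma>_eq: "\<Gamma> = frontier (\<Omega> 1) \<inter> frontier (\<Omega> 2)"
    using assms(2) by (simp add: coupled_domain_def)
  \<comment> \<open>Integrals over \<Gamma> become plain integrals over \<open>S\<close>, so that
    the lemmas on \<open>L2\<close> and \<open>l2_inner\<close> serve the interface as well as the
    subdomains.\<close>
  define S where "S = restrict_space surface_measure \<Gamma>"
  have sets_\<Gamma>: "\<Gamma> \<in> sets surface_measure"
    by (simp add: \<Gamma>_eq sets_surface_measure borel_closed closed_Int)
  have space_S: "space S \<subseteq> \<Gamma>"
    by (auto simp: S_def space_restrict_space)
  have LINT_\<Gamma>: "(LINT x:\<Gamma>|surface_measure. h x) = (LINT x|S. h x)" for h :: "real^'d \<Rightarrow> real"
    using sets_\<Gamma> by (simp add: S_def set_lebesgue_integral_def integral_restrict_space)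

  \<comment> \<open>Integrability of the discrete velocities and of their weighted traces\<close>
  have uV: "u i n \<in> V i" if "i \<in> {1, 2}" "n \<le> M + 1" for i n
    using sol that unfolding ga_vms_solution_def by blast
  have uX: "u i n \<in> X i" if "i \<in> {1, 2}" "n \<le> M + 1" for i n
    using uV[OF that] Vdef[OF that(1)] by (simp add: discretely_div_free_def)
  have u_vel: "u i n \<in> velocity_space (\<Omega> i) \<Gamma>" if "i \<in> {1, 2}" "n \<le> M + 1" for i n
    using uX[OF that] fe[OF that(1)] by (auto simp: fe_velocity_space_def)
  have u_H1: "u i n \<in> H1 (\<Omega> i)" if "i \<in> {1, 2}" "n \<le> M + 1" for i n
    using u_vel[OF that] by (simp add: velocity_space_def)
  have u_L2: "u i n \<in> L2 (lebesgue_on (\<Omega> i))" if "i \<in> {1, 2}" "n \<le> M + 1" for i n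
    using u_H1[OF that] by (simp add: H1_def)
  \<comment> \<open>Elements of \<open>velocity_space\<close> are their own trace, which is square
    integrable on the whole frontier.\<close>
  have u_S: "u i n \<in> L2 S" if i: "i \<in> {1, 2}" and n: "n \<le> M + 1" for i n
    unfolding S_def
  proof (rule L2_restrict_subset)
    show "u i n \<in> L2 (restrict_space surface_measure (frontier (\<Omega> i)))"
      using u_vel[OF i n] by (simp add: velocity_space_def boundary_trace_def)
    show "frontier (\<Omega> i) \<in> sets surface_measure"
      by (simp add: sets_surface_measure borel_closed)
    show "\<Gamma> \<subseteq> frontier (\<Omega> i)"
      using i by (auto simp: \<Gamma>_eq)
  qed (rule sets_\<Gamma>)
  \<comment> \<open>The interface energy |[u]| |u|^2 is cubic in the velocities, so square
    integrability alone does not make it integrable; a pointwise bound on the jump does.\<close>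
  have u_bdd: "\<exists>B. \<forall>x\<in>\<Gamma>. norm (u i n x) \<le> B" if i: "i \<in> {1, 2}" and n: "n \<le> M + 1" for i n
  proof -
    have "\<Gamma> \<subseteq> closure (\<Omega> i)"
      using i by (auto simp: \<Gamma>_eq frontier_def)
    then have "bounded (u i n ` \<Gamma>)"
      using fe_velocity_space_bounded_image[OF fe[OF i] uX[OF i n]]
      by (metis bounded_subset image_mono)
    then show ?thesis
      by (simp add: bounded_iff)
  qed

  \<comment> \<open>The weight is taken at level \<open>n\<close> and the velocity at level
    \<open>m\<close>. Only \<open>m = n + 1\<close> will occur: the weight lags one level
    behind.\<close>
  define w where "w i n m x = sqrt (norm (jump u n x)) *\<^sub>R u i m x" for i n m x
  have w_L2: "w i n m \<in> L2 S" if i: "i \<in> {1, 2}" and n: "n \<le> M + 1" and m: "m \<le> M + 1" for i n m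
  proof -
    obtain B1 B2 where B: "\<forall>x\<in>\<Gamma>. norm (u 1 n x) \<le> B1" "\<forall>x\<in>\<Gamma>. norm (u 2 n x) \<le> B2"
      using u_bdd[of 1 n] u_bdd[of 2 n] n by auto
    have "norm (jump u n x) \<le> B1 + B2" if "x \<in> \<Gamma>" for x
      using B that norm_triangle_ineq4[of "u 1 n x" "u 2 n x"] by (force simp: jump_def)
    then have "\<bar>sqrt (norm (jump u n x))\<bar> \<le> sqrt (B1 + B2)" if "x \<in> space S" for x
      using that space_S by auto
    moreover have "(\<lambda>x. sqrt (norm (jump u n x))) \<in> borel_measurable S"
      unfolding jump_def using u_S[of 1 n] u_S[of 2 n] n
      by (auto dest!: L2_measurable)
    ultimately show ?thesis
      unfolding w_def by (intro L2_scaleR_bounded[OF u_S[OF i m]])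
  qed

  \<comment> \<open>Energy balance on one subdomain over one time step\<close>
  define K where "K i n = (norm_dom (\<Omega> i) (u i n))\<^sup>2" for i n
  define E where "E i n = (norm_dom (\<Omega> i) (wgrad (\<Omega> i) (u i n)))\<^sup>2" for i n
  \<comment> \<open>\<open>J i n\<close> belongs to the velocity at level \<open>n + 1\<close>, so
    the interface energy of level \<open>n\<close> is \<open>J i (n - 1)\<close>.\<close>
  define J where "J i n = (l2_norm S (w i n (n + 1)))\<^sup>2" for i n
  define R where "R i n = (norm_dom (\<Omega> i) (\<lambda>x. u i (n+1) x - u i n x))\<^sup>2" for i n
  define P where "P i n = 2 * \<nu> i * E i (n+1)
      + \<nu>T * (norm_dom (\<Omega> i) (\<lambda>x. wgrad (\<Omega> i) (u i (n+1)) x - G i n x))\<^sup>2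
      + \<nu>T * (norm_dom (\<Omega> i) (\<lambda>x. wgrad (\<Omega> i) (u i n) x - G i n x))\<^sup>2" for i n
  define Z where "Z i j n = (l2_norm S (\<lambda>x. w i n (n+1) x - w j (n-1) n x))\<^sup>2" for i j n
  define F where "F i n = inner_dom (\<Omega> i) (f i (real (n+1) * \<Delta>t)) (u i (n+1))" for i n

  \<comment> \<open>The interface energy on the right carries the index \<open>j\<close> of the
    other subdomain, so this identity does not yet telescope.\<close>
  have step: "K i (n+1) + R i n + \<nu>T * \<Delta>t * E i (n+1) + \<Delta>t * P i n
        + \<kappa> * \<Delta>t * J i n + \<kappa> * \<Delta>t * Z i j n
      = K i n + \<nu>T * \<Delta>t * E i n + \<kappa> * \<Delta>t * J j (n-1) + 2 * \<Delta>t * F i n"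
    if i: "i \<in> {1, 2}" and j: "j \<in> {1, 2}" and ij: "i \<noteq> j" and n: "n \<in> {1..M}" for i j n
  proof -
    \<comment> \<open>Subtraction is truncated: \<open>n - 1 + 1 = n\<close> uses n \<ge> 1, and
      identifies the old interface energy in \<open>Jj\<close>.\<close>
    have n': "n + 1 \<le> M + 1" "n \<le> M + 1" "n - 1 \<le> M + 1" "n - 1 + 1 = n"
      using n by auto
    let ?\<Omega> = "\<Omega> i"
    let ?u = "u i n" and ?u' = "u i (n+1)"
    let ?D = "wgrad ?\<Omega> ?u" and ?D' = "wgrad ?\<Omega> ?u'"
    let ?w = "w j (n-1) n" and ?w' = "w i n (n+1)"
    have G_L: "G i n \<in> L i"
      using sol i n unfolding ga_vms_solution_def by blast
    note scheme = bspec[OF mp[OF bspec[OF bspec[OF conjunct2[OF conjunct2[OF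
      sol[unfolded ga_vms_solution_def]]] i] j] ij] n]
    have momentum: "inner_dom ?\<Omega> (\<lambda>x. (1/\<Delta>t) *\<^sub>R (?u' x - ?u x)) ?u'
        + (\<nu> i + \<nu>T) * inner_dom ?\<Omega> ?D' ?D' + trilinear ?\<Omega> ?u' ?u' ?u'
        + \<kappa> * (LINT x:\<Gamma>|surface_measure. norm (jump u n x) * (?u' x \<bullet> ?u' x))
        - \<kappa> * (LINT x:\<Gamma>|surface_measure.
            sqrt (norm (jump u n x)) * sqrt (norm (jump u (n-1) x)) * (u j n x \<bullet> ?u' x))
        = inner_dom ?\<Omega> (f i (real (n+1) * \<Delta>t)) ?u' + \<nu>T * inner_dom ?\<Omega> (G i n) ?D'"
      by (rule bspec[OF conjunct1[OF scheme] uV[OF i n'(1)]])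
    have projection: "inner_dom ?\<Omega> (\<lambda>x. G i n x - ?D x) (G i n) = 0"
      by (rule bspec[OF conjunct2[OF scheme] G_L])
    have L2: "?u \<in> L2 (lebesgue_on ?\<Omega>)" "?u' \<in> L2 (lebesgue_on ?\<Omega>)"
      "?D \<in> L2 (lebesgue_on ?\<Omega>)" "?D' \<in> L2 (lebesgue_on ?\<Omega>)" "G i n \<in> L2 (lebesgue_on ?\<Omega>)"
      "?w \<in> L2 S" "?w' \<in> L2 S"
      using u_L2[OF i] wgrad_L2[OF u_H1[OF i]] w_L2[OF i] w_L2[OF j] n' G_L large[OF i]
      by (auto simp: large_scale_space_def)
    \<comment> \<open>A square root of the weight goes to each factor. The geometric average in the
      scheme is what makes the coupling term in \<open>w2\<close> an inner product of such weighted
      velocities too.\<close>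
    have w1: "(LINT x:\<Gamma>|surface_measure. norm (jump u n x) * (?u' x \<bullet> ?u' x)) = l2_inner S ?w' ?w'"
      unfolding LINT_\<Gamma> l2_inner_def w_def
      by (intro Bochner_Integration.integral_cong) (simp_all flip: mult.assoc)
    have w2: "(LINT x:\<Gamma>|surface_measure.
        sqrt (norm (jump u n x)) * sqrt (norm (jump u (n-1) x)) * (u j n x \<bullet> ?u' x)) = l2_inner S ?w ?w'"
      unfolding LINT_\<Gamma> l2_inner_def w_def
      by (intro Bochner_Integration.integral_cong) (simp_all add: mult_ac)
    \<comment> \<open>Hence |G|^2 = |D|^2 - |D - G|^2 for the old gradient D, which replaces |G|^2
      by the eddy viscosity energy of the previous level.\<close>
    have proj: "inner_dom ?\<Omega> (G i n) ?D = inner_dom ?\<Omega> (G i n) (G i n)"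
      using projection l2_inner_diff_left[OF L2(5,3,5)]
      by (simp add: l2_inner_commute[of _ ?D])
    \<comment> \<open>The tested equation times \<Delta>t, without the convection term.\<close>
    have mom: "(inner_dom ?\<Omega> ?u' ?u' - inner_dom ?\<Omega> ?u ?u') + \<Delta>t * ((\<nu> i + \<nu>T) * inner_dom ?\<Omega> ?D' ?D')
        + \<kappa> * \<Delta>t * l2_inner S ?w' ?w' - \<kappa> * \<Delta>t * l2_inner S ?w ?w'
        = \<Delta>t * F i n + \<nu>T * \<Delta>t * inner_dom ?\<Omega> (G i n) ?D'"
      using momentum \<open>\<Delta>t > 0\<close> L2 unfolding w1 w2 trilinear_self l2_inner_scaleR_left F_def
      by (simp add: l2_inner_diff_left field_simps)
    have Jj: "J j (n-1) = l2_inner S ?w ?w"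
      by (simp add: J_def n'(4) l2_norm_power2 del: One_nat_def add_Suc_right)
    \<comment> \<open>This is twice \<open>mom\<close>, with polarization for the velocities, the
      gradients and the weighted traces. Norms of differences are expanded first, since
      \<open>l2_norm_power2\<close> would match them as well.\<close>
    show ?thesis
      using mom proj L2
      unfolding Jj K_def E_def R_def P_def Z_def unfolding J_def
      by (simp add: l2_norm_diff_power2) (simp add: l2_norm_power2 algebra_simps)
  qed

  \<comment> \<open>Total energy at level \<open>n\<close>. The sum \<open>J 1 + J 2\<close> is
    symmetric under the exchange of the subdomains, so adding \<open>step\<close> for (1, 2) and (2,
    1) gives a true difference of \<open>S1\<close>.\<close>
  define S1 where "S1 n = K 1 n + K 2 n + \<nu>T * \<Delta>t * (E 1 n + E 2 n) + \<kappa> * \<Delta>t * (J 1 (n-1) + J 2 (n-1))" for n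
  have both: "S1 (n+1) - S1 n = 2 * \<Delta>t * F 1 n + 2 * \<Delta>t * F 2 n - (R 1 n + R 2 n)
      - \<Delta>t * P 1 n - \<Delta>t * P 2 n - \<kappa> * \<Delta>t * Z 1 2 n - \<kappa> * \<Delta>t * Z 2 1 n"
    if "n \<in> {1..M}" for n
    using step[of 1 2 n] step[of 2 1 n] that unfolding S1_def by (simp add: algebra_simps)

  \<comment> \<open>Telescoping over the time levels\<close>
  have "S1 (M+1) - S1 1 = (\<Sum>n=1..M. S1 (n+1) - S1 n)"
    using sum_Suc_diff[of 1 M S1] by simp
  also have "\<dots> = (\<Sum>n=1..M. 2 * \<Delta>t * F 1 n + 2 * \<Delta>t * F 2 n - (R 1 n + R 2 n)
      - \<Delta>t * P 1 n - \<Delta>t * P 2 n - \<kappa> * \<Delta>t * Z 1 2 n - \<kappa> * \<Delta>t * Z 2 1 n)"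
    by (intro sum.cong refl both)
  also have "\<dots> = 2 * \<Delta>t * (\<Sum>n=1..M. F 1 n) + 2 * \<Delta>t * (\<Sum>n=1..M. F 2 n)
      - (\<Sum>n=1..M. R 1 n + R 2 n) - \<Delta>t * (\<Sum>n=1..M. P 1 n) - \<Delta>t * (\<Sum>n=1..M. P 2 n)
      - \<kappa> * \<Delta>t * (\<Sum>n=1..M. Z 1 2 n) - \<kappa> * \<Delta>t * (\<Sum>n=1..M. Z 2 1 n)"
    by (simp only: sum.distrib sum_subtractf sum_distrib_left)
  finally have total: "S1 (M+1) + (\<Sum>n=1..M. R 1 n + R 2 n)
      + \<Delta>t * (\<Sum>n=1..M. P 1 n) + \<Delta>t * (\<Sum>n=1..M. P 2 n)
      + \<kappa> * \<Delta>t * (\<Sum>n=1..M. Z 1 2 n) + \<kappa> * \<Delta>t * (\<Sum>n=1..M. Z 2 1 n)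
      = S1 1 + 2 * \<Delta>t * (\<Sum>n=1..M. F 1 n) + 2 * \<Delta>t * (\<Sum>n=1..M. F 2 n)"
    by simp

  \<comment> \<open>Telescoping leaves the interface energies of the two end levels only:
    \<open>n = M\<close> gives the final one and \<open>n = 0\<close> the initial one, with
    velocities at level 1.\<close>
  have J_sum: "(LINT x:\<Gamma>|surface_measure.
      norm (jump u n x) * ((norm (u 1 (n+1) x))\<^sup>2 + (norm (u 2 (n+1) x))\<^sup>2)) = J 1 n + J 2 n"
    if "n \<le> M" for n
  proof -
    have "J 1 n + J 2 n = (LINT x|S. w 1 n (n+1) x \<bullet> w 1 n (n+1) x + w 2 n (n+1) x \<bullet> w 2 n (n+1) x)"
      using w_L2[of 1 n "n+1"] w_L2[of 2 n "n+1"] that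
      by (simp add: J_def l2_norm_power2 l2_inner_def L2_integrable_inner)
    also have "\<dots> = (LINT x|S. norm (jump u n x) * ((norm (u 1 (n+1) x))\<^sup>2 + (norm (u 2 (n+1) x))\<^sup>2))"
      by (intro Bochner_Integration.integral_cong)
        (simp_all add: w_def power2_norm_eq_inner distrib_left flip: mult.assoc)
    finally show ?thesis
      unfolding LINT_\<Gamma> by simp
  qed
  have Z_eq: "(LINT x:\<Gamma>|surface_measure. (norm (sqrt (norm (jump u n x)) *\<^sub>R u i (n+1) x
      - sqrt (norm (jump u (n-1) x)) *\<^sub>R u j n x))\<^sup>2) = Z i j n" for i j n
    unfolding LINT_\<Gamma> Z_def l2_norm_def w_def by simp
  show ?thesis
    using total J_sum[OF order_refl] J_sum[of 0]
    unfolding Z_eq S1_def F_def[symmetric] R_def[symmetric] K_def[symmetric] E_def[symmetric]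
      P_def[symmetric]
    by (simp add: algebra_simps)
qed

end
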